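(* The large rank of the semigroup $A^+(B_2)$ is $r_5(A^+(B_2)) = 28$.
   Context: Brandt semigroup. For $n\ge 1$ let $[n]=\{1,\dots,n\}$ and $B_n = ([n]\times[n])\cup\{\vartheta\}$, with the (non-commutative) operation $+$ given by $(i,j)+(k,l)=(i,l)$ if $j=k$ and $(i,j)+(k,l)=\vartheta$ otherwise, and $\vartheta+x=x+\vartheta=\vartheta$ for all $x\in B_n$. Affine maps. Arguments of functions are written on the left ($xf$ is the value of $f$ at $x$), so $x(fg)=(xf)g$. Let $M(B_n)$ be the set of all maps $B_n\to B_n$, with pointwise addition $+$ and composition. A map is affine if it equals $g+h$ with $g$ an endomorphism of $(B_n,+)$ and $h$ a constant map; $\mathrm{Aff}(B_n)$ is the set of affine maps. $A^+(B_n)$ is the smallest subset of $M(B_n)$ containing $\mathrm{Aff}(B_n)$ and closed under $+$ and composition; here it is regarded as a semigroup under composition only. Explicit description (known). For $c\in B_n$ let $\xi_c$ be the constant map with value $c$; for $k,l,p,q\in[n]$ let ${}^{(k,l)}\zeta_{(p,q)}$ be the map sending $(k,l)$ to $(p,q)$ and all other elements to $\vartheta$; for $p,q\in[n]$ and a permutation $\sigma\in S_n$ let $(p,q;\sigma)$ be the map sending $(i,p)$ to $(i\sigma,q)$ for all $i\in[n]$ and all other elements to $\vartheta$. For $n\ge 2$, $A^+(B_n)=\{(p,q;\sigma): p,q\in[n],\sigma\in S_n\}\cup\{\xi_c : c\in B_n\}\cup\{{}^{(k,l)}\zeta_{(p,q)}: k,l,p,q\in[n]\}$. Rank. For a finite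 semigroup $\Gamma$, the large rank is $r_5(\Gamma)=\min\{k : \text{every subset } U \text{ of cardinality } k \text{ in } \Gamma \text{ generates } \Gamma\}$ (generation as a semigroup). *)

theory Defs
  imports "HOL-Library.FuncSet"
begin

text \<open>The constructor \<open>El i j\<close> stands for the pair \<open>(i, j)\<close>; the indices are cut down to
  \<open>{1..n}\<close> by the carrier \<open>brandt n\<close>.\<close>

datatype brandt_elt = El nat nat | Theta

definition brandt :: "nat \<Rightarrow> brandt_elt set" where
  "brandt n = {El i j | i j. i \<in> {1..n} \<and> j \<in> {1..n}} \<union> {Theta}"

fun brandt_add :: "brandt_elt \<Rightarrow> brandt_elt \<Rightarrow> brandt_elt" where
  "brandt_add (El i j) (El k l) = (if j = k then El i l else Theta)"
| "brandt_add Theta _ = Theta"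
| "brandt_add _ Theta = Theta"

text \<open>Maps \<open>brandt n \<rightarrow> brandt n\<close> are the extensional functions \<open>brandt n \<rightarrow>\<^sub>E brandt n\<close>, so that
  two maps are equal as soon as they agree on the carrier.\<close>

definition map_add :: "nat \<Rightarrow> (brandt_elt \<Rightarrow> brandt_elt) \<Rightarrow> (brandt_elt \<Rightarrow> brandt_elt)
    \<Rightarrow> (brandt_elt \<Rightarrow> brandt_elt)" where
  "map_add n f g = (\<lambda>x\<in>brandt n. brandt_add (f x) (g x))"

text \<open>Arguments are written on the left, so the product \<open>fg\<close> applies \<open>f\<close> first.\<close>

definition map_mult :: "nat \<Rightarrow> (brandt_elt \<Rightarrow> brandt_elt) \<Rightarrow> (brandt_elt \<Rightarrow> brandt_elt)
    \<Rightarrow> (brandt_elt \<Rightarrow> brandt_elt)" where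
  "map_mult n f g = compose (brandt n) g f"

definition brandt_End :: "nat \<Rightarrow> (brandt_elt \<Rightarrow> brandt_elt) set" where
  "brandt_End n = {g \<in> brandt n \<rightarrow>\<^sub>E brandt n.
     \<forall>x\<in>brandt n. \<forall>y\<in>brandt n. g (brandt_add x y) = brandt_add (g x) (g y)}"

definition const_map :: "nat \<Rightarrow> brandt_elt \<Rightarrow> (brandt_elt \<Rightarrow> brandt_elt)" where
  "const_map n c = (\<lambda>x\<in>brandt n. c)"

definition Aff :: "nat \<Rightarrow> (brandt_elt \<Rightarrow> brandt_elt) set" where
  "Aff n = {map_add n g (const_map n c) | g c. g \<in> brandt_End n \<and> c \<in> brandt n}"

inductive_set A_plus :: "nat \<Rightarrow> (brandt_elt \<Rightarrow> brandt_elt) set" for n :: nat where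
  affine: "f \<in> Aff n \<Longrightarrow> f \<in> A_plus n"
| add: "f \<in> A_plus n \<Longrightarrow> g \<in> A_plus n \<Longrightarrow> map_add n f g \<in> A_plus n"
| mult: "f \<in> A_plus n \<Longrightarrow> g \<in> A_plus n \<Longrightarrow> map_mult n f g \<in> A_plus n"

inductive_set semigroup_gen :: "('a \<Rightarrow> 'a \<Rightarrow> 'a) \<Rightarrow> 'a set \<Rightarrow> 'a set"
  for mult :: "'a \<Rightarrow> 'a \<Rightarrow> 'a" and U :: "'a set" where
  incl: "x \<in> U \<Longrightarrow> x \<in> semigroup_gen mult U"
| closed: "x \<in> semigroup_gen mult U \<Longrightarrow> y \<in> semigroup_gen mult U \<Longrightarrow> mult x y \<in> semigroup_gen mult U"

text \<open>For a finite semigroup with carrier \<open>S\<close> the minimum exists, since \<open>k = card S\<close> always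
  qualifies.\<close>

definition large_rank :: "('a \<Rightarrow> 'a \<Rightarrow> 'a) \<Rightarrow> 'a set \<Rightarrow> nat" where
  "large_rank mult S =
     (LEAST k. \<forall>U. U \<subseteq> S \<and> finite U \<and> card U = k \<longrightarrow> semigroup_gen mult U = S)"

end

theory Submission
  imports Defs "HOL-Combinatorics.Permutations"
begin

text \<open>The large rank of a finite semigroup is one more than the size of its largest proper
  subsemigroup. In \<open>A\<^sup>+(B\<^sub>n)\<close>, \<open>n \<ge> 2\<close>, every element is a product of two elements different from
  it, so no subsemigroup misses exactly one element. For \<open>n = 2\<close> the two maps \<open>(1,2;\<sigma>)\<close> can be
  left out simultaneously: a product of two maps equals some \<open>(1,2;\<sigma>)\<close> only if it has the form
  \<open>(1,q;\<alpha>)(q,2;\<beta>)\<close>, and one of the factors is again a \<open>(1,2;\<cdot>)\<close>. So the largest proper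
  subsemigroup has \<open>27\<close> of the \<open>8 + 5 + 16 = 29\<close> elements.\<close>

section \<open>Large rank and maximal subsemigroups\<close>

lemma semigroup_gen_subset:
  assumes "U \<subseteq> T" "\<And>x y. x \<in> T \<Longrightarrow> y \<in> T \<Longrightarrow> m x y \<in> T"
  shows "semigroup_gen m U \<subseteq> T"
proof
  fix x assume "x \<in> semigroup_gen m U"
  then show "x \<in> T" by induction (use assms in auto)
qed

lemma large_rank_eqI:
  fixes m :: "'a \<Rightarrow> 'a \<Rightarrow> 'a"
  assumes fin: "finite S"
    and S_closed: "\<And>x y. x \<in> S \<Longrightarrow> y \<in> S \<Longrightarrow> m x y \<in> S"
    and decomp: "\<And>a. a \<in> S \<Longrightarrow> \<exists>b \<in> S - {a}. \<exists>c \<in> S - {a}. m b c = a"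
    and T_sub: "T \<subseteq> S"
    and T_closed: "\<And>x y. x \<in> T \<Longrightarrow> y \<in> T \<Longrightarrow> m x y \<in> T"
    and card_T: "card S = card T + 2"
  shows "large_rank m S = card S - 1"
  unfolding large_rank_def
proof (rule Least_equality, intro allI impI)
  fix U assume U: "U \<subseteq> S \<and> finite U \<and> card U = card S - 1"
  then have "card (S - U) = 1"
    using card_T fin by (simp add: card_Diff_subset)
  then obtain a where a: "S - U = {a}"
    by (auto simp: card_1_singleton_iff)
  then have "S - {a} \<subseteq> semigroup_gen m U"
    by (auto intro: semigroup_gen.incl)
  moreover have "a \<in> semigroup_gen m U"
  proof -
    have "a \<in> S" using a by auto
    then obtain b c where "b \<in> S - {a}" "c \<in> S - {a}" "m b c = a"
      using decomp by blast
    then show ?thesis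
      using calculation semigroup_gen.closed[of b m U c] by auto
  qed
  moreover have "semigroup_gen m U \<subseteq> S"
    using U S_closed by (intro semigroup_gen_subset) auto
  ultimately show "semigroup_gen m U = S" by auto
next
  fix k assume k: "\<forall>U. U \<subseteq> S \<and> finite U \<and> card U = k \<longrightarrow> semigroup_gen m U = S"
  show "card S - 1 \<le> k"
  proof (rule ccontr)
    assume "\<not> card S - 1 \<le> k"
    \<comment> \<open>By \<open>card_T\<close>, \<open>card S - 1\<close> is
      \<open>card T + 1\<close>, so a smaller \<open>k\<close> still fits inside \<open>T\<close>,
      where every generated subsemigroup stays proper.\<close>
    then have "k \<le> card T" using card_T by simp
    then obtain U where U: "U \<subseteq> T" "card U = k" "finite U"
      by (rule obtain_subset_with_card_n)
    then have "semigroup_gen m U = S" using k T_sub by auto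
    moreover have "semigroup_gen m U \<subseteq> T"
      using U(1) T_closed by (rule semigroup_gen_subset)
    ultimately have "S \<subseteq> T" by simp
    then have "S = T" using T_sub by auto
    then show False using card_T by simp
  qed
qed

section \<open>The elements of \<open>A\<^sup>+(B\<^sub>n)\<close>\<close>

lemma El_in_brandt [simp]: "El i j \<in> brandt n \<longleftrightarrow> i \<in> {1..n} \<and> j \<in> {1..n}"
  and Theta_in_brandt [simp]: "Theta \<in> brandt n"
  by (auto simp: brandt_def)

lemma brandt_add_Theta [simp]: "brandt_add x Theta = Theta"
  by (cases x) auto

lemma brandt_add_closed: "x \<in> brandt n \<Longrightarrow> y \<in> brandt n \<Longrightarrow> brandt_add x y \<in> brandt n"
  by (cases x; cases y) auto

text \<open>The map \<open>perm_map n p q \<sigma>\<close> is written \<open>(p,q;\<sigma>)\<close> on paper.\<close>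

definition perm_map :: "nat \<Rightarrow> nat \<Rightarrow> nat \<Rightarrow> (nat \<Rightarrow> nat) \<Rightarrow> brandt_elt \<Rightarrow> brandt_elt" where
  "perm_map n p q \<sigma> = (\<lambda>x\<in>brandt n.
     case x of El i j \<Rightarrow> if j = p then El (\<sigma> i) q else Theta | Theta \<Rightarrow> Theta)"

text \<open>On paper \<open>k l\<close> is the upper left index of zeta and \<open>p q\<close> the
  lower right one.\<close>

definition zeta_map :: "nat \<Rightarrow> nat \<Rightarrow> nat \<Rightarrow> nat \<Rightarrow> nat \<Rightarrow> brandt_elt \<Rightarrow> brandt_elt" where
  "zeta_map n k l p q = (\<lambda>x\<in>brandt n. if x = El k l then El p q else Theta)"

definition perm_maps :: "nat \<Rightarrow> (brandt_elt \<Rightarrow> brandt_elt) set" where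
  "perm_maps n = {perm_map n p q \<sigma> | p q \<sigma>. p \<in> {1..n} \<and> q \<in> {1..n} \<and> \<sigma> permutes {1..n}}"

definition const_maps :: "nat \<Rightarrow> (brandt_elt \<Rightarrow> brandt_elt) set" where
  "const_maps n = const_map n ` brandt n"

definition zeta_maps :: "nat \<Rightarrow> (brandt_elt \<Rightarrow> brandt_elt) set" where
  "zeta_maps n = {zeta_map n k l p q | k l p q.
     k \<in> {1..n} \<and> l \<in> {1..n} \<and> p \<in> {1..n} \<and> q \<in> {1..n}}"

lemmas map_defs = perm_map_def zeta_map_def const_map_def map_add_def map_mult_def compose_def

lemma permutes_atLeastAtMost:
  "\<sigma> permutes {1..n} \<Longrightarrow> i \<in> {1..n} \<Longrightarrow> \<sigma> i \<in> {1..n}" for \<sigma> :: "nat \<Rightarrow> nat"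
  by (simp only: permutes_in_image)

lemma perm_map_in_brandt:
  assumes "q \<in> {1..n}" "\<sigma> permutes {1..n}"
  shows "perm_map n p q \<sigma> \<in> brandt n \<rightarrow>\<^sub>E brandt n"
proof (rule PiE_I)
  fix x assume "x \<in> brandt n"
  then show "perm_map n p q \<sigma> x \<in> brandt n"
    using assms permutes_atLeastAtMost[OF assms(2)] by (cases x) (auto simp: perm_map_def)
qed (simp add: perm_map_def)

lemma description_in_brandt:
  assumes "f \<in> perm_maps n \<union> const_maps n \<union> zeta_maps n"
  shows "f \<in> brandt n \<rightarrow>\<^sub>E brandt n"
proof -
  consider "f \<in> perm_maps n" | "f \<in> const_maps n" | "f \<in> zeta_maps n" using assms by auto
  then show ?thesis
  proof cases
    case 1
    then obtain p q \<sigma> where "f = perm_map n p q \<sigma>" "q \<in> {1..n}" "\<sigma> permutes {1..n}"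
      by (auto simp: perm_maps_def)
    then show ?thesis using perm_map_in_brandt by simp
  qed (auto simp: const_maps_def zeta_maps_def map_defs)
qed

text \<open>A recognition criterion for the closure proofs: once the support of a sum or product is
  known to have at most one point, its values need not be computed. An empty support gives the zero
  constant, a single point gives a zeta map.\<close>

lemma sparse_map_in_description:
  assumes f: "f \<in> brandt n \<rightarrow>\<^sub>E brandt n"
    and uniq: "\<And>x y. x \<in> brandt n \<Longrightarrow> y \<in> brandt n \<Longrightarrow> f x \<noteq> Theta \<Longrightarrow> f y \<noteq> Theta \<Longrightarrow> x = y"
    and zero: "f Theta = Theta"
  shows "f \<in> const_maps n \<union> zeta_maps n"
proof (cases "\<exists>x \<in> brandt n. f x \<noteq> Theta")
  case True
  then obtain x where x: "x \<in> brandt n" "f x \<noteq> Theta" by auto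
  \<comment> \<open>The hypothesis \<open>zero\<close> excludes \<open>Theta\<close> as the point of
    support.\<close>
  obtain k l where kl: "x = El k l" using x zero by (cases x) auto
  obtain p q where pq: "f x = El p q" using x by (cases "f x") auto
  have "f x \<in> brandt n" using f x by auto
  moreover have "f = zeta_map n k l p q"
  proof (rule extensionalityI[of _ "brandt n"])
    show "f y = zeta_map n k l p q y" if "y \<in> brandt n" for y
    proof (cases "y = x")
      case True
      then show ?thesis using that kl pq by (simp add: zeta_map_def)
    next
      case False
      then have "f y = Theta" using uniq[OF x(1) that x(2)] by auto
      then show ?thesis using that kl False by (simp add: zeta_map_def)
    qed
  qed (use f in \<open>auto simp: zeta_map_def PiE_def\<close>)
  ultimately show ?thesis
    using x kl pq by (auto simp: zeta_maps_def)
next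
  case False
  then have "f = const_map n Theta"
    using f by (intro extensionalityI[of _ "brandt n"]) (auto simp: const_map_def PiE_def)
  then show ?thesis by (auto simp: const_maps_def)
qed

section \<open>Values and product formulas for the listed maps\<close>

lemma perm_map_El [simp]:
  "i \<in> {1..n} \<Longrightarrow> p \<in> {1..n} \<Longrightarrow> perm_map n p q \<sigma> (El i p) = El (\<sigma> i) q"
  by (simp add: perm_map_def)

lemma perm_map_Theta [simp]: "perm_map n p q \<sigma> Theta = Theta"
  by (simp add: perm_map_def)

lemma zeta_map_Theta [simp]: "zeta_map n k l p q Theta = Theta"
  by (simp add: zeta_map_def)

text \<open>The left factor acts first, hence the order \<open>\<tau> \<circ> \<sigma>\<close>. Its
  nonzero values all have second coordinate \<open>q\<close>, while the right factor kills every
  pair whose second coordinate is not \<open>r\<close>.\<close>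

lemma perm_map_mult:
  assumes "\<sigma> permutes {1..n}" "q \<in> {1..n}"
  shows "map_mult n (perm_map n p q \<sigma>) (perm_map n r s \<tau>) =
    (if q = r then perm_map n p s (\<tau> \<circ> \<sigma>) else const_map n Theta)"
proof
  fix x
  show "map_mult n (perm_map n p q \<sigma>) (perm_map n r s \<tau>) x =
    (if q = r then perm_map n p s (\<tau> \<circ> \<sigma>) else const_map n Theta) x"
    using assms permutes_atLeastAtMost[OF assms(1)] by (cases x) (auto simp: map_defs)
qed

lemma zeta_map_mult_perm_map:
  assumes "p \<in> {1..n}" "q \<in> {1..n}"
  shows "map_mult n (zeta_map n k l p q) (perm_map n q s \<tau>) = zeta_map n k l (\<tau> p) s"
  using assms by (auto simp: map_defs)

lemma const_map_mult: "c \<in> brandt n \<Longrightarrow> map_mult n (const_map n c) f = const_map n (f c)"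
  by (auto simp: map_defs)

lemma map_mult_const:
  "f \<in> brandt n \<rightarrow>\<^sub>E brandt n \<Longrightarrow> map_mult n f (const_map n c) = const_map n c"
  by (auto simp: map_defs fun_eq_iff)

lemma map_add_const_const:
  "map_add n (const_map n c) (const_map n d) = const_map n (brandt_add c d)"
  by (auto simp: map_defs)

section \<open>Closure under both operations\<close>

lemma map_add_in_brandt:
  "f \<in> brandt n \<rightarrow>\<^sub>E brandt n \<Longrightarrow> g \<in> brandt n \<rightarrow>\<^sub>E brandt n \<Longrightarrow> map_add n f g \<in> brandt n \<rightarrow>\<^sub>E brandt n"
  by (auto simp: map_add_def intro: brandt_add_closed)

lemma map_mult_in_brandt:
  "f \<in> brandt n \<rightarrow>\<^sub>E brandt n \<Longrightarrow> g \<in> brandt n \<rightarrow>\<^sub>E brandt n \<Longrightarrow> map_mult n f g \<in> brandt n \<rightarrow>\<^sub>E brandt n"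
  by (auto simp: map_mult_def compose_def)

lemma zeta_mapD:
  "f \<in> zeta_maps n \<Longrightarrow> \<exists>z. \<forall>x \<in> brandt n. f x \<noteq> Theta \<longrightarrow> x = z"
  by (auto simp: zeta_maps_def zeta_map_def)

lemma zeta_maps_Theta: "f \<in> zeta_maps n \<Longrightarrow> f Theta = Theta"
  by (auto simp: zeta_maps_def)

text \<open>Since \<open>Theta\<close> absorbs, a sum is supported only where both summands are.
  This settles the cases with a zeta map. For constant plus permutation map, or for two permutation
  maps, a nonzero sum prescribes the image of \<open>i\<close> under an injective map, so again at
  most one point remains. Only permutation map plus constant can keep a whole column.\<close>

lemma description_add_closed:
  assumes "f \<in> perm_maps n \<union> const_maps n \<union> zeta_maps n"
    and "g \<in> perm_maps n \<union> const_maps n \<union> zeta_maps n"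
  shows "map_add n f g \<in> perm_maps n \<union> const_maps n \<union> zeta_maps n"
proof -
  have fg: "map_add n f g \<in> brandt n \<rightarrow>\<^sub>E brandt n"
    using assms by (intro map_add_in_brandt description_in_brandt)
  have sparse: ?thesis
    if "\<And>x y. x \<in> brandt n \<Longrightarrow> y \<in> brandt n \<Longrightarrow> map_add n f g x \<noteq> Theta
        \<Longrightarrow> map_add n f g y \<noteq> Theta \<Longrightarrow> x = y" "map_add n f g Theta = Theta"
  proof -
    have "map_add n f g \<in> const_maps n \<union> zeta_maps n"
      using fg that by (rule sparse_map_in_description)
    then show ?thesis by blast
  qed
  consider (zeta1) "f \<in> zeta_maps n" | (zeta2) "g \<in> zeta_maps n"
    | (const_const) "f \<in> const_maps n" "g \<in> const_maps n"
    | (perm_const) "f \<in> perm_maps n" "g \<in> const_maps n"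
    | (const_perm) "f \<in> const_maps n" "g \<in> perm_maps n"
    | (perm_perm) "f \<in> perm_maps n" "g \<in> perm_maps n"
    using assms by blast
  then show ?thesis
  proof cases
    case zeta1
    then obtain z where "\<forall>x \<in> brandt n. f x \<noteq> Theta \<longrightarrow> x = z" using zeta_mapD by blast
    then have "\<forall>x \<in> brandt n. map_add n f g x \<noteq> Theta \<longrightarrow> x = z"
      by (force simp: map_add_def)
    moreover have "map_add n f g Theta = Theta"
      using zeta1 by (simp add: map_add_def zeta_maps_Theta)
    ultimately show ?thesis by (intro sparse) auto
  next
    case zeta2
    then obtain z where "\<forall>x \<in> brandt n. g x \<noteq> Theta \<longrightarrow> x = z" using zeta_mapD by blast
    then have "\<forall>x \<in> brandt n. map_add n f g x \<noteq> Theta \<longrightarrow> x = z"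
      by (force simp: map_add_def)
    moreover have "map_add n f g Theta = Theta"
      using zeta2 by (simp add: map_add_def zeta_maps_Theta)
    ultimately show ?thesis by (intro sparse) auto
  next
    case const_const
    then show ?thesis
      by (auto simp: const_maps_def map_add_const_const intro!: imageI brandt_add_closed)
  next
    case perm_const
    then obtain p q \<sigma> c where *: "f = perm_map n p q \<sigma>" "p \<in> {1..n}" "q \<in> {1..n}"
        "\<sigma> permutes {1..n}" "g = const_map n c" "c \<in> brandt n"
      by (auto simp: perm_maps_def const_maps_def)
    have "map_add n f g = (case c of El a b \<Rightarrow> if q = a then perm_map n p b \<sigma> else const_map n Theta
        | Theta \<Rightarrow> const_map n Theta)"
      unfolding * by (rule ext) (auto simp: map_defs split: brandt_elt.splits)
    then show ?thesis
      using * by (auto simp: perm_maps_def const_maps_def split: brandt_elt.splits)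
  next
    case const_perm
    then obtain p q \<sigma> c where *: "g = perm_map n p q \<sigma>" "p \<in> {1..n}" "q \<in> {1..n}"
        "\<sigma> permutes {1..n}" "f = const_map n c" "c \<in> brandt n"
      by (auto simp: perm_maps_def const_maps_def)
    have nz: "\<exists>i a b. x = El i p \<and> c = El a b \<and> b = \<sigma> i"
      if "x \<in> brandt n" "map_add n f g x \<noteq> Theta" for x
      using that unfolding * by (cases x; cases c) (auto simp: map_defs split: if_splits)
    have "x = y" if "x \<in> brandt n" "y \<in> brandt n"
        "map_add n f g x \<noteq> Theta" "map_add n f g y \<noteq> Theta" for x y
      using nz[OF that(1,3)] nz[OF that(2,4)] permutes_inj[OF *(4)] by (auto dest: injD)
    then show ?thesis by (rule sparse) (simp_all add: * map_add_def)
  next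
    case perm_perm
    then obtain p q \<sigma> r s \<tau> where *: "f = perm_map n p q \<sigma>" "\<sigma> permutes {1..n}"
        "g = perm_map n r s \<tau>" "\<tau> permutes {1..n}"
      by (auto simp: perm_maps_def)
    have nz: "\<exists>i. x = El i p \<and> q = \<tau> i"
      if "x \<in> brandt n" "map_add n f g x \<noteq> Theta" for x
      using that unfolding * by (cases x) (auto simp: map_defs split: if_splits)
    have "x = y" if "x \<in> brandt n" "y \<in> brandt n"
        "map_add n f g x \<noteq> Theta" "map_add n f g y \<noteq> Theta" for x y
      using nz[OF that(1,3)] nz[OF that(2,4)] permutes_inj[OF *(4)] by (auto dest: injD)
    then show ?thesis by (rule sparse) (simp_all add: * map_add_def)
  qed
qed

text \<open>A constant factor makes the product constant. A zeta map on either side leaves at most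
  one point of support: on the left by its own support, on the right because a permutation map sends
  only one point to the source of the zeta map.\<close>

lemma description_mult_closed:
  assumes "f \<in> perm_maps n \<union> const_maps n \<union> zeta_maps n"
    and "g \<in> perm_maps n \<union> const_maps n \<union> zeta_maps n"
  shows "map_mult n f g \<in> perm_maps n \<union> const_maps n \<union> zeta_maps n"
proof -
  note f = description_in_brandt[OF assms(1)] and g = description_in_brandt[OF assms(2)]
  have sparse: ?thesis
    if "\<And>x y. x \<in> brandt n \<Longrightarrow> y \<in> brandt n \<Longrightarrow> map_mult n f g x \<noteq> Theta
        \<Longrightarrow> map_mult n f g y \<noteq> Theta \<Longrightarrow> x = y" "map_mult n f g Theta = Theta"
  proof -
    have "map_mult n f g \<in> const_maps n \<union> zeta_maps n"
      using map_mult_in_brandt[OF f g] that by (rule sparse_map_in_description)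
    then show ?thesis by blast
  qed
  \<comment> \<open>Nonconstant right factors fix \<open>Theta\<close>, so they cannot enlarge the
    support of the left factor.\<close>
  have "g \<in> const_maps n \<or> g Theta = Theta"
    using assms(2) by (auto simp: zeta_maps_Theta perm_maps_def)
  then
  consider (const1) "f \<in> const_maps n" | (const2) "g \<in> const_maps n"
    | (zeta_any) "f \<in> zeta_maps n" "g Theta = Theta"
    | (perm_zeta) "f \<in> perm_maps n" "g \<in> zeta_maps n"
    | (perm_perm) "f \<in> perm_maps n" "g \<in> perm_maps n"
    using assms by blast
  then show ?thesis
  proof cases
    case const1
    then show ?thesis using g by (auto simp: const_maps_def const_map_mult)
  next
    case const2
    then show ?thesis using f by (auto simp: const_maps_def map_mult_const)
  next
    case zeta_any
    then obtain z where "\<forall>x \<in> brandt n. f x \<noteq> Theta \<longrightarrow> x = z" using zeta_mapD by blast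
    then have "\<forall>x \<in> brandt n. map_mult n f g x \<noteq> Theta \<longrightarrow> x = z"
      using zeta_any(2) by (force simp: map_mult_def compose_def)
    moreover have "map_mult n f g Theta = Theta"
      using zeta_any by (simp add: map_mult_def compose_def zeta_maps_Theta)
    ultimately show ?thesis by (intro sparse) auto
  next
    case perm_zeta
    then obtain p q \<sigma> k l r s where *: "f = perm_map n p q \<sigma>" "\<sigma> permutes {1..n}"
        "q \<in> {1..n}" "g = zeta_map n k l r s"
      by (auto simp: perm_maps_def zeta_maps_def)
    have nz: "\<exists>i. x = El i p \<and> k = \<sigma> i"
      if "x \<in> brandt n" "map_mult n f g x \<noteq> Theta" for x
      using that permutes_atLeastAtMost[OF *(2)] *(3) unfolding *(1,4)
      by (cases x) (auto simp: map_defs split: if_splits)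
    have "x = y" if "x \<in> brandt n" "y \<in> brandt n"
        "map_mult n f g x \<noteq> Theta" "map_mult n f g y \<noteq> Theta" for x y
      using nz[OF that(1,3)] nz[OF that(2,4)] permutes_inj[OF *(2)] by (auto dest: injD)
    then show ?thesis by (rule sparse) (simp_all add: * map_mult_def compose_def)
  next
    case perm_perm
    then obtain p q \<sigma> r s \<tau> where "f = perm_map n p q \<sigma>" "p \<in> {1..n}" "q \<in> {1..n}"
        "\<sigma> permutes {1..n}" "g = perm_map n r s \<tau>" "s \<in> {1..n}" "\<tau> permutes {1..n}"
      by (auto simp: perm_maps_def)
    then show ?thesis
      using permutes_compose[of \<sigma> "{1..n}" \<tau>]
      by (auto simp: perm_map_mult perm_maps_def const_maps_def)
  qed
qed

section \<open>Endomorphisms and affine maps\<close>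

text \<open>For a permutation \<open>\<sigma>\<close> of the indices this is the induced
  automorphism of the Brandt semigroup.\<close>

definition perm_End :: "nat \<Rightarrow> (nat \<Rightarrow> nat) \<Rightarrow> brandt_elt \<Rightarrow> brandt_elt" where
  "perm_End n \<sigma> = (\<lambda>x\<in>brandt n. case x of El i j \<Rightarrow> El (\<sigma> i) (\<sigma> j) | Theta \<Rightarrow> Theta)"

lemma perm_End_in_brandt_End:
  assumes "\<sigma> permutes {1..n}"
  shows "perm_End n \<sigma> \<in> brandt_End n"
proof -
  have "perm_End n \<sigma> \<in> brandt n \<rightarrow>\<^sub>E brandt n"
  proof (rule PiE_I)
    fix x assume "x \<in> brandt n"
    then show "perm_End n \<sigma> x \<in> brandt n"
      using permutes_atLeastAtMost[OF assms] by (cases x) (auto simp: perm_End_def)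
  qed (simp add: perm_End_def)
  moreover have "perm_End n \<sigma> (brandt_add x y) = brandt_add (perm_End n \<sigma> x) (perm_End n \<sigma> y)"
    if "x \<in> brandt n" "y \<in> brandt n" for x y
    using that permutes_inj[OF assms] by (cases x; cases y) (auto simp: perm_End_def dest: injD)
  ultimately show ?thesis by (simp add: brandt_End_def)
qed

lemma const_map_in_brandt_End:
  assumes "c \<in> brandt n" "brandt_add c c = c"
  shows "const_map n c \<in> brandt_End n"
  using assms by (auto simp: brandt_End_def const_map_def brandt_add_closed)

text \<open>A nonzero value at \<open>Theta\<close> forces \<open>g\<close> to be constant. If
  \<open>Theta\<close> is fixed and some pair goes to \<open>Theta\<close>, everything does.
  Otherwise the idempotents \<open>El i i\<close> go to nonzero idempotents, which are pairwise
  different and so define the permutation.\<close>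

lemma brandt_End_cases:
  assumes "g \<in> brandt_End n"
  obtains (const) c where "c \<in> brandt n" "g = const_map n c"
  | (perm) \<sigma> where "\<sigma> permutes {1..n}" "g = perm_End n \<sigma>"
proof -
  have g: "g \<in> brandt n \<rightarrow>\<^sub>E brandt n"
    and hom: "\<And>x y. x \<in> brandt n \<Longrightarrow> y \<in> brandt n \<Longrightarrow> g (brandt_add x y) = brandt_add (g x) (g y)"
    using assms by (auto simp: brandt_End_def)
  have homEl: "g (El i l) = brandt_add (g (El i j)) (g (El j l))"
    if "i \<in> {1..n}" "j \<in> {1..n}" "l \<in> {1..n}" for i j l
    using hom[of "El i j" "El j l"] that by simp
  have homTheta: "g Theta = brandt_add (g x) (g Theta)" "g Theta = brandt_add (g Theta) (g x)"
    if "x \<in> brandt n" for x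
    using hom[OF that Theta_in_brandt, unfolded brandt_add_Theta]
      hom[OF Theta_in_brandt that, unfolded brandt_add.simps(2)] .
  show ?thesis
  proof (cases "g Theta")
    case (El a b)
    \<comment> \<open>The value \<open>El a b\<close> absorbs \<open>g x\<close> from both sides,
      which fixes both coordinates of \<open>g x\<close>.\<close>
    have "g x = El a b" if "x \<in> brandt n" for x
      using homTheta[OF that, unfolded El, symmetric] by (cases "g x") (auto split: if_splits)
    then have "g = const_map n (El a b)"
      using g by (intro extensionalityI[of _ "brandt n"]) (auto simp: const_map_def PiE_def)
    moreover have "El a b \<in> brandt n" using PiE_mem[OF g Theta_in_brandt] El by simp
    ultimately show ?thesis using const by blast
  next
    case zero: Theta
    show ?thesis
    proof (cases "\<exists>i \<in> {1..n}. \<exists>j \<in> {1..n}. g (El i j) = Theta")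
      case True
      then obtain i j where ij: "i \<in> {1..n}" "j \<in> {1..n}" "g (El i j) = Theta" by auto
      \<comment> \<open>Every pair factors through the killed one:
        \<open>(k,l) = (k,i) + (i,j) + (j,l)\<close>.\<close>
      have "g (El k l) = Theta" if "k \<in> {1..n}" "l \<in> {1..n}" for k l
        using homEl[of k i l] homEl[of i j l] ij that by simp
      then have "g x = Theta" if "x \<in> brandt n" for x
        using zero that by (cases x) auto
      then have "g = const_map n Theta"
        using g by (intro extensionalityI[of _ "brandt n"]) (auto simp: const_map_def PiE_def)
      then show ?thesis using const[OF Theta_in_brandt] by simp
    next
      case False
      then have nonzero: "g (El i j) \<noteq> Theta" if "i \<in> {1..n}" "j \<in> {1..n}" for i j
        using that by blast
      have diag: "\<exists>a. g (El i i) = El a a" if i: "i \<in> {1..n}" for i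
      proof -
        obtain a b where ab: "g (El i i) = El a b" using nonzero[OF i i] by (cases "g (El i i)") auto
        \<comment> \<open>\<open>El i i\<close> is idempotent, and a nonzero idempotent has equal
          coordinates.\<close>
        show ?thesis using homEl[OF i i i, unfolded ab, symmetric] ab by (auto split: if_splits)
      qed
      \<comment> \<open>The default value \<open>i\<close> outside \<open>{1..n}\<close> is what
        \<open>permutes\<close> demands there.\<close>
      define \<sigma> where "\<sigma> i = (if i \<in> {1..n} then SOME a. g (El i i) = El a a else i)" for i
      have \<sigma>: "g (El i i) = El (\<sigma> i) (\<sigma> i)" if "i \<in> {1..n}" for i
        using someI_ex[OF diag[OF that]] that by (simp add: \<sigma>_def)
      have El: "g (El i j) = El (\<sigma> i) (\<sigma> j)" if ij: "i \<in> {1..n}" "j \<in> {1..n}" for i j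
      proof -
        obtain a b where ab: "g (El i j) = El a b" using nonzero[OF ij] by (cases "g (El i j)") auto
        have "brandt_add (El (\<sigma> i) (\<sigma> i)) (El a b) = El a b"
          using homEl[OF ij(1,1,2)] by (simp only: ab \<sigma>[OF ij(1)])
        then have "\<sigma> i = a" by (rule contrapos_pp) simp
        moreover have "brandt_add (El a b) (El (\<sigma> j) (\<sigma> j)) = El a b"
          using homEl[OF ij(1,2,2)] by (simp only: ab \<sigma>[OF ij(2)])
        then have "b = \<sigma> j" by (rule contrapos_pp) simp
        ultimately show ?thesis by (simp only: ab)
      qed
      have "\<sigma> ` {1..n} \<subseteq> {1..n}"
      proof
        fix a assume "a \<in> \<sigma> ` {1..n}"
        then obtain i where "i \<in> {1..n}" "a = \<sigma> i" by auto
        moreover from this have "g (El i i) \<in> brandt n" by (intro PiE_mem[OF g]) simp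
        ultimately show "a \<in> {1..n}" by (simp add: \<sigma> del: atLeastAtMost_iff)
      qed
      moreover have "inj_on \<sigma> {1..n}"
      proof (rule inj_onI, rule ccontr)
        fix i j assume ij: "i \<in> {1..n}" "j \<in> {1..n}" "\<sigma> i = \<sigma> j" "i \<noteq> j"
        \<comment> \<open>Different diagonal idempotents add up to \<open>Theta\<close>; a common
          nonzero idempotent image would add up to itself.\<close>
        then have "g Theta = brandt_add (g (El i i)) (g (El j j))"
          using hom[of "El i i" "El j j"] by simp
        then show False using ij \<sigma> zero by simp
      qed
      ultimately have "bij_betw \<sigma> {1..n} {1..n}"
        by (simp add: bij_betw_def endo_inj_surj)
      then have "\<sigma> permutes {1..n}"
        by (rule bij_imp_permutes) (auto simp: \<sigma>_def)
      moreover have "g = perm_End n \<sigma>"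
      proof (rule extensionalityI[of _ "brandt n"])
        show "g x = perm_End n \<sigma> x" if "x \<in> brandt n" for x
          using that El zero by (cases x) (auto simp: perm_End_def)
      qed (use g in \<open>auto simp: perm_End_def PiE_def\<close>)
      ultimately show ?thesis using perm by blast
    qed
  qed
qed

section \<open>Affine maps and the explicit description\<close>

lemma perm_End_add_const:
  assumes "\<sigma> permutes {1..n}"
  shows "map_add n (perm_End n \<sigma>) (const_map n (El (\<sigma> p) q)) = perm_map n p q \<sigma>"
proof
  fix x
  show "map_add n (perm_End n \<sigma>) (const_map n (El (\<sigma> p) q)) x = perm_map n p q \<sigma> x"
    \<comment> \<open>Adding \<open>El (\<sigma> p) q\<close> on the right keeps exactly the pairs
      with \<open>\<sigma> j = \<sigma> p\<close>, that is, the column \<open>j = p\<close>.\<close>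
    using permutes_inj[OF assms] by (cases x) (auto simp: perm_End_def map_defs dest: injD)
qed

lemma perm_End_add_const_Theta:
  "map_add n (perm_End n \<sigma>) (const_map n Theta) = const_map n Theta"
  by (auto simp: map_defs)

lemma perm_map_in_Aff:
  assumes "p \<in> {1..n}" "q \<in> {1..n}" "\<sigma> permutes {1..n}"
  shows "perm_map n p q \<sigma> \<in> Aff n"
  using perm_End_add_const[OF assms(3), of p q, symmetric] perm_End_in_brandt_End[OF assms(3)]
    permutes_atLeastAtMost[OF assms(3,1)] assms
  by (fastforce simp: Aff_def)

text \<open>Each \<open>c\<close> has an idempotent left identity \<open>e\<close>, namely
  \<open>El p p\<close> for \<open>c = El p q\<close>; the constant map with value \<open>e\<close>
  is an endomorphism.\<close>

lemma const_map_in_Aff: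
  assumes "c \<in> brandt n"
  shows "const_map n c \<in> Aff n"
proof -
  have "\<exists>e \<in> brandt n. brandt_add e e = e \<and> brandt_add e c = c"
  proof (cases c)
    case (El p q)
    then show ?thesis using assms by (intro bexI[of _ "El p p"]) auto
  qed (auto intro: bexI[of _ Theta])
  then obtain e where e: "e \<in> brandt n" "brandt_add e e = e" "brandt_add e c = c" by auto
  then have "const_map n c = map_add n (const_map n e) (const_map n c)"
    by (simp add: map_add_const_const)
  then show ?thesis
    using const_map_in_brandt_End[OF e(1,2)] assms by (auto simp: Aff_def)
qed

lemma Aff_subset: "Aff n \<subseteq> perm_maps n \<union> const_maps n"
proof
  fix f assume "f \<in> Aff n"
  then obtain g c where gc: "g \<in> brandt_End n" "c \<in> brandt n" "f = map_add n g (const_map n c)"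
    by (auto simp: Aff_def)
  from gc(1) show "f \<in> perm_maps n \<union> const_maps n"
  proof (cases rule: brandt_End_cases)
    case (const d)
    then show ?thesis
      using gc brandt_add_closed by (auto simp: map_add_const_const const_maps_def)
  next
    case (perm \<sigma>)
    show ?thesis
    proof (cases c)
      case (El a q)
      then have "a \<in> \<sigma> ` {1..n}" "q \<in> {1..n}"
        using gc(2) permutes_image[OF perm(1)] by auto
      \<comment> \<open>Surjectivity of \<open>\<sigma>\<close> brings every pair \<open>c\<close>
        into the form \<open>El (\<sigma> p) q\<close>.\<close>
      then obtain p where "p \<in> {1..n}" "a = \<sigma> p" by auto
      then show ?thesis
        using gc perm El perm_End_add_const[OF perm(1), of p q] by (auto simp: perm_maps_def)
    qed (use gc perm in \<open>auto simp: perm_End_add_const_Theta const_maps_def\<close>)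
  qed
qed

text \<open>The affine maps already supply the permutation maps and the constants. The zeta maps
  arise as sums of these, and the three families together are closed under both operations.\<close>

theorem A_plus_eq: "A_plus n = perm_maps n \<union> const_maps n \<union> zeta_maps n"
proof
  show "A_plus n \<subseteq> perm_maps n \<union> const_maps n \<union> zeta_maps n"
  proof
    fix f assume "f \<in> A_plus n"
    then show "f \<in> perm_maps n \<union> const_maps n \<union> zeta_maps n"
      by induction (use Aff_subset description_add_closed description_mult_closed in blast)+
  qed
next
  have "zeta_map n k l p q \<in> A_plus n"
    if "k \<in> {1..n}" "l \<in> {1..n}" "p \<in> {1..n}" "q \<in> {1..n}" for k l p q
  proof -
    \<comment> \<open>On the column \<open>l\<close> this sum is \<open>(p,k) + (i,q)\<close>, which
      is nonzero only for \<open>i = k\<close>.\<close>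
    have "zeta_map n k l p q = map_add n (const_map n (El p k)) (perm_map n l q id)"
      using that by (auto simp: map_defs split: brandt_elt.splits)
    moreover have "const_map n (El p k) \<in> A_plus n" "perm_map n l q id \<in> A_plus n"
      using that by (auto intro!: A_plus.affine perm_map_in_Aff const_map_in_Aff permutes_id)
    ultimately show ?thesis by (simp add: A_plus.add)
  qed
  then show "perm_maps n \<union> const_maps n \<union> zeta_maps n \<subseteq> A_plus n"
    by (auto simp: perm_maps_def const_maps_def zeta_maps_def
        intro!: A_plus.affine[OF perm_map_in_Aff] A_plus.affine[OF const_map_in_Aff])
qed

section \<open>Counting\<close>

lemma perm_map_eqD:
  assumes eq: "perm_map n p q \<sigma> = perm_map n p' q' \<sigma>'"
    and "p \<in> {1..n}" "\<sigma> permutes {1..n}" "\<sigma>' permutes {1..n}"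
  shows "p = p' \<and> q = q' \<and> \<sigma> = \<sigma>'"
proof -
  have El: "El (\<sigma> i) q = (if p = p' then El (\<sigma>' i) q' else Theta)" if "i \<in> {1..n}" for i
    using fun_cong[OF eq, of "El i p"] that assms(2) by (simp add: perm_map_def)
  have "p = p' \<and> q = q'"
    using El[OF assms(2)] by (auto split: if_splits)
  moreover have "\<sigma> = \<sigma>'"
  proof
    fix i show "\<sigma> i = \<sigma>' i"
      using El[of i] permutes_not_in[OF assms(3), of i] permutes_not_in[OF assms(4), of i]
      by (cases "i \<in> {1..n}") (auto split: if_splits)
  qed
  ultimately show ?thesis by simp
qed

lemma zeta_map_eqD:
  assumes eq: "zeta_map n k l p q = zeta_map n k' l' p' q'" and "k \<in> {1..n}" "l \<in> {1..n}"
  shows "k = k' \<and> l = l' \<and> p = p' \<and> q = q'"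
  using fun_cong[OF eq, of "El k l"] assms(2,3) by (simp add: zeta_map_def split: if_splits)

lemma const_map_eq_iff [simp]: "const_map n c = const_map n d \<longleftrightarrow> c = d"
proof
  assume "const_map n c = const_map n d"
  from fun_cong[OF this, of Theta] show "c = d" by (simp add: const_map_def)
qed simp

lemma perm_map_neq_const_map: "p \<in> {1..n} \<Longrightarrow> perm_map n p q \<sigma> \<noteq> const_map n c"
proof
  assume p: "p \<in> {1..n}" and eq: "perm_map n p q \<sigma> = const_map n c"
  show False
    using fun_cong[OF eq, of Theta] fun_cong[OF eq, of "El p p"] p by (simp add: const_map_def)
qed

text \<open>A permutation map is nonzero on a column of \<open>n\<close> points, a zeta map on at
  most one. For \<open>n = 1\<close> the two families coincide.\<close>

lemma perm_map_neq_zeta_map: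
  assumes "n \<ge> 2" "p \<in> {1..n}"
  shows "perm_map n p q \<sigma> \<noteq> zeta_map n k l r s"
proof
  assume eq: "perm_map n p q \<sigma> = zeta_map n k l r s"
  show False
    using fun_cong[OF eq, of "El 1 p"] fun_cong[OF eq, of "El 2 p"] assms
    by (simp add: zeta_map_def split: if_splits)
qed

lemma zeta_map_neq_const_map:
  assumes "k \<in> {1..n}" "l \<in> {1..n}"
  shows "zeta_map n k l p q \<noteq> const_map n c"
proof
  assume eq: "zeta_map n k l p q = const_map n c"
  show False
    using fun_cong[OF eq, of Theta] fun_cong[OF eq, of "El k l"] assms
    by (simp add: const_map_def zeta_map_def)
qed

section \<open>Sizes of the three families\<close>

lemma finite_card_perm_maps: "finite (perm_maps n)" "card (perm_maps n) = n * n * fact n"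
proof -
  let ?A = "{1..n} \<times> {1..n} \<times> {\<sigma>. \<sigma> permutes {1..n}}"
  have eq: "perm_maps n = (\<lambda>(p, q, \<sigma>). perm_map n p q \<sigma>) ` ?A"
    by (force simp: perm_maps_def)
  show "finite (perm_maps n)" unfolding eq by (intro finite_imageI) (simp add: finite_permutations)
  have "inj_on (\<lambda>(p, q, \<sigma>). perm_map n p q \<sigma>) ?A"
    by (rule inj_onI) (auto dest!: perm_map_eqD)
  then show "card (perm_maps n) = n * n * fact n"
    by (simp add: eq card_image card_cartesian_product card_permutations)
qed

lemma brandt_eq: "brandt n = insert Theta ((\<lambda>(i, j). El i j) ` ({1..n} \<times> {1..n}))"
  by (auto simp: brandt_def)

lemma finite_card_const_maps: "finite (const_maps n)" "card (const_maps n) = n * n + 1"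
proof -
  have "card (brandt n) = n * n + 1"
  proof -
    have "inj_on (\<lambda>(i, j). El i j) ({1..n} \<times> {1..n})" by (auto intro: inj_onI)
    then show ?thesis
      unfolding brandt_eq by (subst card_insert_disjoint) (auto simp: card_image)
  qed
  moreover have "inj_on (const_map n) (brandt n)" by (auto intro: inj_onI)
  ultimately show "card (const_maps n) = n * n + 1" by (simp add: const_maps_def card_image)
  show "finite (const_maps n)" by (simp add: const_maps_def brandt_eq)
qed

lemma finite_card_zeta_maps: "finite (zeta_maps n)" "card (zeta_maps n) = n * n * (n * n)"
proof -
  let ?A = "({1..n} \<times> {1..n}) \<times> ({1..n} \<times> {1..n})"
  have eq: "zeta_maps n = (\<lambda>((k, l), (p, q)). zeta_map n k l p q) ` ?A"
  proof
    show "zeta_maps n \<subseteq> (\<lambda>((k, l), (p, q)). zeta_map n k l p q) ` ?A"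
    proof
      fix f assume "f \<in> zeta_maps n"
      then obtain k l p q where "f = (\<lambda>((k, l), (p, q)). zeta_map n k l p q) ((k, l), (p, q))"
          "((k, l), (p, q)) \<in> ?A"
        by (auto simp: zeta_maps_def)
      then show "f \<in> (\<lambda>((k, l), (p, q)). zeta_map n k l p q) ` ?A" by (rule image_eqI)
    qed
    show "(\<lambda>((k, l), (p, q)). zeta_map n k l p q) ` ?A \<subseteq> zeta_maps n"
      unfolding zeta_maps_def by clarify blast
  qed
  show "finite (zeta_maps n)" unfolding eq by (intro finite_imageI) simp
  have "inj_on (\<lambda>((k, l), (p, q)). zeta_map n k l p q) ?A"
    by (rule inj_onI) (auto dest!: zeta_map_eqD)
  then show "card (zeta_maps n) = n * n * (n * n)"
    by (simp add: eq card_image card_cartesian_product)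
qed

lemma finite_A_plus: "finite (A_plus n)"
  by (simp add: A_plus_eq finite_card_perm_maps finite_card_const_maps finite_card_zeta_maps)

lemma card_A_plus:
  assumes "n \<ge> 2"
  shows "card (A_plus n) = n * n * fact n + (n * n + 1) + n * n * (n * n)"
proof -
  have "perm_maps n \<inter> const_maps n = {}"
    by (auto simp: perm_maps_def const_maps_def perm_map_neq_const_map[symmetric])
  moreover have "perm_maps n \<inter> zeta_maps n = {}"
    unfolding perm_maps_def zeta_maps_def using perm_map_neq_zeta_map[OF assms] by blast
  moreover have "const_maps n \<inter> zeta_maps n = {}"
    by (auto simp: const_maps_def zeta_maps_def zeta_map_neq_const_map[symmetric])
  ultimately show ?thesis
    unfolding A_plus_eq
    by (simp add: card_Un_disjoint Int_Un_distrib2 finite_card_perm_maps finite_card_const_maps finite_card_zeta_maps)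
qed

section \<open>Products\<close>

lemma A_plus_decomposition:
  assumes n: "n \<ge> 2" and a: "a \<in> A_plus n"
  shows "\<exists>b \<in> A_plus n - {a}. \<exists>c \<in> A_plus n - {a}. map_mult n b c = a"
proof -
  have other: "\<exists>r \<in> {1..n}. r \<noteq> p" for p
    using n by (intro bexI[of _ "if p = 1 then 2 else 1"]) auto
  have swap: "transpose p r permutes {1..n}" if "p \<in> {1..n}" "r \<in> {1..n}" for p r
    using that by (rule permutes_swap_id)
  have permI: "perm_map n p q \<sigma> \<in> A_plus n"
    if "p \<in> {1..n}" "q \<in> {1..n}" "\<sigma> permutes {1..n}" for p q \<sigma>
    using that by (auto simp: A_plus_eq perm_maps_def)
  have constI: "const_map n c \<in> A_plus n" if "c \<in> brandt n" for c
    using that by (auto simp: A_plus_eq const_maps_def)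
  have zetaI: "zeta_map n k l p q \<in> A_plus n"
    if "k \<in> {1..n}" "l \<in> {1..n}" "p \<in> {1..n}" "q \<in> {1..n}" for k l p q
    using that by (auto simp: A_plus_eq zeta_maps_def)
  consider (perm) p q \<sigma> where "p \<in> {1..n}" "q \<in> {1..n}" "\<sigma> permutes {1..n}" "a = perm_map n p q \<sigma>"
    | (zero) "a = const_map n Theta"
    | (const) p q where "p \<in> {1..n}" "q \<in> {1..n}" "a = const_map n (El p q)"
    | (zeta) k l p q where "k \<in> {1..n}" "l \<in> {1..n}" "p \<in> {1..n}" "q \<in> {1..n}"
        "a = zeta_map n k l p q"
    using a by (auto simp: A_plus_eq perm_maps_def const_maps_def zeta_maps_def brandt_def)
  then show ?thesis
  proof cases
    case perm
    obtain r where r: "r \<in> {1..n}" "r \<noteq> p" using other by blast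
    show ?thesis
    proof (cases "p = q")
      case True
      \<comment> \<open>A detour through another column \<open>r\<close>: both factors differ from
        \<open>a\<close> in their column indices.\<close>
      have "perm_map n p r \<sigma> \<noteq> a" "perm_map n r p id \<noteq> a"
        using perm r True perm_map_eqD permutes_id by metis+
      moreover have "map_mult n (perm_map n p r \<sigma>) (perm_map n r p id) = a"
        using perm r True by (simp add: perm_map_mult)
      ultimately show ?thesis
        using perm r permI permutes_id by (metis Diff_iff singletonD)
    next
      case False
      \<comment> \<open>For \<open>n = 2\<close> the only column other than \<open>p\<close> is
        \<open>q\<close>, so here the permutation is altered instead: \<open>?t\<close> moves
        \<open>p\<close>, hence \<open>\<sigma> \<circ> ?t\<close> differs from
        \<open>\<sigma>\<close>, and the involution \<open>?t\<close> in the first factor cancels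
        the change.\<close>
      let ?t = "transpose p r"
      have t: "?t permutes {1..n}" using swap perm r by blast
      have st: "\<sigma> \<circ> ?t permutes {1..n}" using permutes_compose[OF t perm(3)] .
      have "\<sigma> (?t p) \<noteq> \<sigma> p" using r permutes_inj[OF perm(3)] by (auto dest: injD)
      then have "\<sigma> \<circ> ?t \<noteq> \<sigma>" by (metis comp_apply)
      then have "perm_map n p q (\<sigma> \<circ> ?t) \<noteq> a"
        using perm st perm_map_eqD by metis
      moreover have "perm_map n p p ?t \<noteq> a"
        using perm t False perm_map_eqD by metis
      moreover have "map_mult n (perm_map n p p ?t) (perm_map n p q (\<sigma> \<circ> ?t)) = a"
        using perm t by (simp add: perm_map_mult comp_assoc)
      ultimately show ?thesis
        using perm t st permI by (metis Diff_iff singletonD)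
    qed
  next
    case zero
    \<comment> \<open>Mismatched columns give the zero map as a product of nonzero maps.\<close>
    have "map_mult n (perm_map n 1 1 id) (perm_map n 2 2 id) = a"
      using n zero by (simp add: perm_map_mult permutes_id)
    moreover have "perm_map n 1 1 id \<in> A_plus n - {a}" "perm_map n 2 2 id \<in> A_plus n - {a}"
      using n zero perm_map_neq_const_map permI permutes_id by auto
    ultimately show ?thesis by blast
  next
    case const
    obtain r where r: "r \<in> {1..n}" "r \<noteq> p" using other by blast
    \<comment> \<open>The first coordinate is changed to \<open>r\<close> and moved back by a
      transposition; the zeta case works in the same way.\<close>
    have "map_mult n (const_map n (El r q)) (perm_map n q q (transpose r p)) = a"
      using const r by (simp add: const_map_mult)
    moreover have "const_map n (El r q) \<in> A_plus n - {a}"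
      using const r constI by auto
    moreover have "perm_map n q q (transpose r p) \<in> A_plus n - {a}"
      using const r permI swap perm_map_neq_const_map by auto
    ultimately show ?thesis by blast
  next
    case zeta
    obtain r where r: "r \<in> {1..n}" "r \<noteq> p" using other by blast
    have "map_mult n (zeta_map n k l r q) (perm_map n q q (transpose r p)) = a"
      using zeta r by (simp add: zeta_map_mult_perm_map)
    moreover have "zeta_map n k l r q \<in> A_plus n - {a}"
      using zeta r zetaI by (auto dest: zeta_map_eqD)
    moreover have "perm_map n q q (transpose r p) \<in> A_plus n - {a}"
      using zeta r permI swap perm_map_neq_zeta_map[OF n] by auto
    ultimately show ?thesis by blast
  qed
qed

text \<open>This converse of \<open>perm_map_mult\<close> shows that a product of two maps is a
  permutation map only if both factors are. The product is nonconstant and takes at least two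
  different nonzero values, whereas a constant factor would make it constant and a zeta factor would
  leave at most one nonzero value.\<close>

lemma perm_map_factors:
  assumes n: "n \<ge> 2" and f: "f \<in> A_plus n" and g: "g \<in> A_plus n"
    and p: "p \<in> {1..n}" and \<rho>: "\<rho> permutes {1..n}"
    and eq: "map_mult n f g = perm_map n p s \<rho>"
  obtains q \<sigma> \<tau> where "q \<in> {1..n}" "\<sigma> permutes {1..n}" "\<tau> permutes {1..n}"
    "f = perm_map n p q \<sigma>" "g = perm_map n q s \<tau>"
proof -
  have fB: "f \<in> brandt n \<rightarrow>\<^sub>E brandt n"
    using f unfolding A_plus_eq by (rule description_in_brandt)
  have nz: "g (f (El i p)) = El (\<rho> i) s" if "i \<in> {1..n}" for i
    using fun_cong[OF eq, of "El i p"] that p by (simp add: map_mult_def compose_def)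
  have z: "g (f Theta) = Theta"
    using fun_cong[OF eq, of Theta] by (simp add: map_mult_def compose_def)
  have "f \<notin> const_maps n"
    using eq const_map_mult perm_map_neq_const_map[OF p] by (metis const_maps_def imageE)
  moreover have "g \<notin> const_maps n"
    using eq map_mult_const[OF fB] perm_map_neq_const_map[OF p] by (metis const_maps_def imageE)
  moreover have "f \<notin> zeta_maps n"
  proof
    assume f: "f \<in> zeta_maps n"
    then have zero: "f Theta = Theta" by (rule zeta_maps_Theta)
    obtain z where "\<forall>x \<in> brandt n. f x \<noteq> Theta \<longrightarrow> x = z" using f zeta_mapD by blast
    \<comment> \<open>If \<open>f\<close> took the value \<open>Theta = f Theta\<close> at one of
      these points, the product would vanish there by \<open>z\<close>, against
      \<open>nz\<close>.\<close>
    moreover have "f (El 1 p) \<noteq> Theta" "f (El 2 p) \<noteq> Theta"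
      using nz[of 1] nz[of 2] z zero n by auto
    ultimately have "El 1 p = z" "El 2 p = z" using n p by auto
    then show False by auto
  qed
  moreover have "g \<notin> zeta_maps n"
  proof
    assume "g \<in> zeta_maps n"
    then obtain k l a b where gz: "g = zeta_map n k l a b" by (auto simp: zeta_maps_def)
    have "El (\<rho> i) s = El a b" if i: "i \<in> {1..n}" for i
    proof -
      have "f (El i p) \<in> brandt n" using fB by (rule PiE_mem) (use i p in simp)
      then have "g (f (El i p)) \<in> {El a b, Theta}" by (simp add: gz zeta_map_def)
      then show ?thesis unfolding nz[OF i] by simp
    qed
    \<comment> \<open>A zeta map has a single nonzero value, so \<open>\<rho>\<close> would not be
      injective.\<close>
    from this[of 1] this[of 2] have "\<rho> 1 = \<rho> 2" using n by simp
    then show False using injD[OF permutes_inj[OF \<rho>], of 1 2] by simp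
  qed
  ultimately have "f \<in> perm_maps n" "g \<in> perm_maps n" using f g unfolding A_plus_eq by blast+
  then obtain p' q \<sigma> r s' \<tau> where *: "p' \<in> {1..n}" "q \<in> {1..n}" "\<sigma> permutes {1..n}"
      "f = perm_map n p' q \<sigma>" "r \<in> {1..n}" "\<tau> permutes {1..n}" "g = perm_map n r s' \<tau>"
    by (auto simp: perm_maps_def)
  have "perm_map n p s \<rho> = (if q = r then perm_map n p' s' (\<tau> \<circ> \<sigma>) else const_map n Theta)"
    using eq unfolding *(4,7) perm_map_mult[OF *(3,2)] by (rule sym)
  then have "q = r" "perm_map n p s \<rho> = perm_map n p' s' (\<tau> \<circ> \<sigma>)"
    using perm_map_neq_const_map[OF p] by (auto split: if_splits)
  moreover from this have "p = p' \<and> s = s'"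
    using perm_map_eqD[OF _ p \<rho> permutes_compose[OF *(3,6)]] by blast
  ultimately show ?thesis using that * by blast
qed

theorem theorem5p4: "large_rank (map_mult 2) (A_plus 2) = 28"
proof -
  let ?R = "{perm_map 2 1 2 \<sigma> | \<sigma>. \<sigma> permutes {1..2}}"
  let ?T = "A_plus 2 - ?R"
  have card: "card (A_plus 2) = 29"
    by (simp add: card_A_plus fact_numeral)
  have "?R = perm_map 2 1 2 ` {\<sigma>. \<sigma> permutes {1..2}}" by auto
  moreover have "inj_on (perm_map 2 1 2) {\<sigma>. \<sigma> permutes {1..2}}"
    by (rule inj_onI) (auto dest!: perm_map_eqD)
  ultimately have "card ?R = 2"
    by (simp add: card_image card_permutations[of _ 2])
  moreover have "?R \<subseteq> A_plus 2" by (force simp: A_plus_eq perm_maps_def)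
  ultimately have card_T: "card (A_plus 2) = card ?T + 2"
    using card finite_A_plus[of 2] finite_subset[of ?R] by (simp add: card_Diff_subset)
  have T_closed: "map_mult 2 f g \<in> ?T" if fg: "f \<in> ?T" "g \<in> ?T" for f g
  proof
    show "map_mult 2 f g \<in> A_plus 2" using fg by (auto intro: A_plus.mult)
    show "map_mult 2 f g \<notin> ?R"
    proof
      assume "map_mult 2 f g \<in> ?R"
      then obtain \<rho> where \<rho>: "\<rho> permutes {1..2}" "map_mult 2 f g = perm_map 2 1 2 \<rho>" by auto
      obtain q \<sigma> \<tau> where "q \<in> {1..2}" "\<sigma> permutes {1..2}" "\<tau> permutes {1..2}"
          "f = perm_map 2 1 q \<sigma>" "g = perm_map 2 q 2 \<tau>"
        by (rule perm_map_factors[of 2 f g 1 \<rho> 2]) (use fg \<rho> in auto)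
      \<comment> \<open>For \<open>q = 1\<close> the right factor \<open>g\<close> lies in
        \<open>?R\<close>, for \<open>q = 2\<close> the left factor \<open>f\<close> does.\<close>
      moreover from this have "q = 1 \<or> q = 2" by auto
      ultimately show False using fg by auto
    qed
  qed
  have "large_rank (map_mult 2) (A_plus 2) = card (A_plus 2) - 1"
    by (rule large_rank_eqI[OF finite_A_plus A_plus.mult A_plus_decomposition[OF order_refl]
          Diff_subset T_closed card_T])
  then show ?thesis using card by simp
qed

end
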